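(* Let $\tilde S_A(x),\tilde S_B(x)$ be the encoding matrix polynomials, $y_1,\dots,y_K\in\mathbb{R}$ the interpolation points and $\alpha_1,\dots,\alpha_K\in\mathbb{R}$ the scalar coefficients of a point-based coding scheme, so that $C=AB=\sum_{k=1}^K\alpha_k\tilde S_A(y_k)\tilde S_B(y_k)$. Let $N\ge 2K-1$ workers be divided into $K$ groups of sizes $n_1,\dots,n_K$, $\sum_{k=1}^K n_k=N$, and let $m\in\{1,\dots,2K-2\}$. Let $m_k$ be the (random) number of workers of group $k$ among the $m$ fastest workers (the first $m$ to complete), so that $\sum_{k=1}^K m_k=m$, and let $$C_m=\sum_{k=1}^K\alpha_k\tilde S_A(y_k)\tilde S_B(y_k)\,\mathbf{1}_{m_k>0}.$$ If the order of completion of the $N$ workers is uniform over all permutations, then the optimal choice of $\beta$ that minimizes the expected approximation error $\mathbb{E}\left(\|C-\beta C_m\|_F^2\right)$, where the expectation is taken with respect to the random variables $m_k$, is $$\beta^*=\frac{\left(\sum_{i=1}^K\tilde M_i\gamma_i\right)+\left(\sum_{i,j=1,\,i<j}^K\tilde M_{i,j}(\gamma_i+\gamma_j)\right)}{\left(\sum_{i=1}^K\tilde M_i\gamma_i\right)+2\left(\sum_{i,j=1,\,i<j}^K\tilde M_{i,j}\gamma_{i,j}\right)},$$ where $$\tilde M_i=\alpha_i^2\|\tilde S_A(y_i)\tilde S_B(y_i)\|_F^2,\qquad \tilde M_{i,j}=\alpha_i\alpha_j\operatorname{Tr}\left(\left(\tilde S_A(y_i)\tilde S_B(y_i)\right)^T\left(\tilde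 S_A(y_j)\tilde S_B(y_j)\right)\right),$$ $$\gamma_i=\frac{\binom{N}{m}-\binom{N-n_i}{m}}{\binom{N}{m}},\qquad \gamma_{i,j}=\frac{\binom{N}{m}-\binom{N-n_i}{m}-\binom{N-n_j}{m}+\binom{N-n_i-n_j}{m}}{\binom{N}{m}}.$$
   Context: $A\in\mathbb{R}^{N_x\times N_z}$ is partitioned into $K$ equal column blocks, $A=[A_1,\dots,A_K]$, and $B\in\mathbb{R}^{N_z\times N_y}$ into $K$ equal row blocks, $B^T=[B_1^T,\dots,B_K^T]$, where $K$ divides $N_z$; thus $AB=\sum_{k=1}^K A_kB_k$. In a point-based coding scheme one takes a polynomial basis $\{T_k(x)\}$ whose first $K$ members $T_0,\dots,T_{K-1}$ have maximum degree $K-1$, and sets $\tilde S_A(x)=\sum_{k=1}^K A_kT_{k-1}(x)$ and $\tilde S_B(x)=\sum_{k=1}^K B_kT_{k-1}(x)$. It is assumed of such a scheme that there are interpolation points $y_1,\dots,y_K$ and scalars $\alpha_1,\dots,\alpha_K$ with $AB=\sum_{k=1}^K\alpha_k\tilde S_A(y_k)\tilde S_B(y_k)$. Each worker multiplies $\tilde S_A$ and $\tilde S_B$ evaluated at its own real point; the $n_k$ workers of group $k$ use $n_k$ distinct points within distance $\epsilon$ of $y_k$, and $C_m$ is the $\epsilon\to0$ limit of the estimate formed from the results of the $m$ fastest workers. The only randomness is in the order of completion of the workers. $\|\cdot\|_F$ is the Frobenius norm, $\operatorname{Tr}$ the trace, $\mathbf{1}_{m_k>0}$ equals $1$ if $m_k>0$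 and $0$ otherwise, and $\binom{a}{b}=0$ when $0\le a<b$. *)

theory Defs
  imports
    "HOL-Probability.Probability_Mass_Function"
    "HOL-Combinatorics.Permutations"
    "HOL-Computational_Algebra.Polynomial"
    "Jordan_Normal_Form.Matrix"
begin

definition mat_sum :: "nat \<Rightarrow> nat \<Rightarrow> ('i \<Rightarrow> real mat) \<Rightarrow> 'i set \<Rightarrow> real mat" where
  "mat_sum nr nc F I = mat nr nc (\<lambda>(i, j). \<Sum>k\<in>I. F k $$ (i, j))"

definition mat_trace :: "real mat \<Rightarrow> real" where
  "mat_trace M = (\<Sum>i<dim_row M. M $$ (i, i))"

definition frob_norm :: "real mat \<Rightarrow> real" where
  "frob_norm M = sqrt (\<Sum>i<dim_row M. \<Sum>j<dim_col M. (M $$ (i, j))\<^sup>2)"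

text \<open>Blocks are numbered from 1; matrix entries are numbered from 0.\<close>

definition col_block :: "nat \<Rightarrow> real mat \<Rightarrow> nat \<Rightarrow> real mat" where
  "col_block K A k =
     (let w = dim_col A div K
      in mat (dim_row A) w (\<lambda>(i, j). A $$ (i, (k - 1) * w + j)))"

definition row_block :: "nat \<Rightarrow> real mat \<Rightarrow> nat \<Rightarrow> real mat" where
  "row_block K B k =
     (let h = dim_row B div K
      in mat h (dim_col B) (\<lambda>(i, j). B $$ ((k - 1) * h + i, j)))"

definition encode_A :: "nat \<Rightarrow> (nat \<Rightarrow> real poly) \<Rightarrow> real mat \<Rightarrow> real \<Rightarrow> real mat" where
  "encode_A K T A x =
     mat_sum (dim_row A) (dim_col A div K)
       (\<lambda>k. poly (T (k - 1)) x \<cdot>\<^sub>m col_block K A k) {1..K}"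

definition encode_B :: "nat \<Rightarrow> (nat \<Rightarrow> real poly) \<Rightarrow> real mat \<Rightarrow> real \<Rightarrow> real mat" where
  "encode_B K T B x =
     mat_sum (dim_row B div K) (dim_col B)
       (\<lambda>k. poly (T (k - 1)) x \<cdot>\<^sub>m row_block K B k) {1..K}"

definition encoded_product ::
  "nat \<Rightarrow> (nat \<Rightarrow> real poly) \<Rightarrow> real mat \<Rightarrow> real mat \<Rightarrow> real \<Rightarrow> real mat" where
  "encoded_product K T A B x = encode_A K T A x * encode_B K T B x"

text \<open>The type of real polynomials is not an instance of the class of real vector spaces,
  so the linear-algebra notions are taken relative to polynomial scalar multiplication.\<close>

lemma vector_space_poly: "vector_space (Polynomial.smult :: real \<Rightarrow> real poly \<Rightarrow> real poly)"
  by unfold_locales (simp_all add: smult_add_left smult_add_right)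

definition polynomial_basis :: "(nat \<Rightarrow> real poly) \<Rightarrow> bool" where
  "polynomial_basis T \<longleftrightarrow>
     inj T \<and>
     \<not> Modules.module.dependent Polynomial.smult (range T) \<and>
     Modules.module.span Polynomial.smult (range T) = UNIV"

definition point_based_scheme ::
  "nat \<Rightarrow> nat \<Rightarrow> nat \<Rightarrow> nat \<Rightarrow> real mat \<Rightarrow> real mat \<Rightarrow> (nat \<Rightarrow> real poly) \<Rightarrow>
   (nat \<Rightarrow> real) \<Rightarrow> (nat \<Rightarrow> real) \<Rightarrow> bool" where
  "point_based_scheme Nx Nz Ny K A B T y \<alpha> \<longleftrightarrow>
     K > 0 \<and> K dvd Nz \<and> A \<in> carrier_mat Nx Nz \<and> B \<in> carrier_mat Nz Ny \<and>
     polynomial_basis T \<and> (MAX k\<in>{..<K}. degree (T k)) = K - 1 \<and>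
     A * B = mat_sum Nx Ny (\<lambda>k. \<alpha> k \<cdot>\<^sub>m encoded_product K T A B (y k)) {1..K}"

definition worker_groups ::
  "nat \<Rightarrow> nat \<Rightarrow> (nat \<Rightarrow> nat set) \<Rightarrow> (nat \<Rightarrow> nat) \<Rightarrow> bool" where
  "worker_groups N K G n \<longleftrightarrow>
     disjoint_family_on G {1..K} \<and> (\<Union>k\<in>{1..K}. G k) = {1..N} \<and>
     (\<forall>k\<in>{1..K}. card (G k) = n k)"

text \<open>A completion order is a permutation \<open>\<pi>\<close> of the workers,
  where \<open>\<pi> p\<close> is the worker that finishes in position \<open>p\<close>.\<close>

definition group_count :: "(nat \<Rightarrow> nat set) \<Rightarrow> nat \<Rightarrow> (nat \<Rightarrow> nat) \<Rightarrow> nat \<Rightarrow> nat" where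
  "group_count G m \<pi> k = card (G k \<inter> \<pi> ` {1..m})"

definition estimate ::
  "nat \<Rightarrow> (nat \<Rightarrow> real poly) \<Rightarrow> real mat \<Rightarrow> real mat \<Rightarrow> (nat \<Rightarrow> real) \<Rightarrow> (nat \<Rightarrow> real) \<Rightarrow>
   (nat \<Rightarrow> nat set) \<Rightarrow> nat \<Rightarrow> (nat \<Rightarrow> nat) \<Rightarrow> real mat" where
  "estimate K T A B y \<alpha> G m \<pi> =
     mat_sum (dim_row A) (dim_col B)
       (\<lambda>k. (\<alpha> k * of_bool (group_count G m \<pi> k > 0)) \<cdot>\<^sub>m encoded_product K T A B (y k)) {1..K}"

definition expected_error ::
  "(nat \<Rightarrow> nat) pmf \<Rightarrow> nat \<Rightarrow> (nat \<Rightarrow> real poly) \<Rightarrow> real mat \<Rightarrow> real mat \<Rightarrow> (nat \<Rightarrow> real) \<Rightarrow>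
   (nat \<Rightarrow> real) \<Rightarrow> (nat \<Rightarrow> nat set) \<Rightarrow> nat \<Rightarrow> real \<Rightarrow> real" where
  "expected_error D K T A B y \<alpha> G m \<beta> =
     measure_pmf.expectation D
       (\<lambda>\<pi>. (frob_norm (A * B - \<beta> \<cdot>\<^sub>m estimate K T A B y \<alpha> G m \<pi>))\<^sup>2)"

definition M_single ::
  "nat \<Rightarrow> (nat \<Rightarrow> real poly) \<Rightarrow> real mat \<Rightarrow> real mat \<Rightarrow> (nat \<Rightarrow> real) \<Rightarrow> (nat \<Rightarrow> real) \<Rightarrow>
   nat \<Rightarrow> real" where
  "M_single K T A B y \<alpha> i = (\<alpha> i)\<^sup>2 * (frob_norm (encoded_product K T A B (y i)))\<^sup>2"

definition M_pair ::
  "nat \<Rightarrow> (nat \<Rightarrow> real poly) \<Rightarrow> real mat \<Rightarrow> real mat \<Rightarrow> (nat \<Rightarrow> real) \<Rightarrow> (nat \<Rightarrow> real) \<Rightarrow>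
   nat \<Rightarrow> nat \<Rightarrow> real" where
  "M_pair K T A B y \<alpha> i j =
     \<alpha> i * \<alpha> j *
     mat_trace (transpose_mat (encoded_product K T A B (y i)) * encoded_product K T A B (y j))"

definition gamma_single :: "nat \<Rightarrow> nat \<Rightarrow> (nat \<Rightarrow> nat) \<Rightarrow> nat \<Rightarrow> real" where
  "gamma_single N m n i =
     (real (N choose m) - real ((N - n i) choose m)) / real (N choose m)"

definition gamma_pair :: "nat \<Rightarrow> nat \<Rightarrow> (nat \<Rightarrow> nat) \<Rightarrow> nat \<Rightarrow> nat \<Rightarrow> real" where
  "gamma_pair N m n i j =
     (real (N choose m) - real ((N - n i) choose m) - real ((N - n j) choose m)
       + real ((N - n i - n j) choose m)) / real (N choose m)"

end

theory Submission
  imports Defs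
begin

text \<open>The error is a nonnegative quadratic polynomial
  \<open>\<parallel>C\<parallel>\<^sup>2 - 2 \<beta> E \<langle>C, C\<^sub>m\<rangle> + \<beta>\<^sup>2 E \<parallel>C\<^sub>m\<parallel>\<^sup>2\<close> in \<open>\<beta>\<close>, minimised at the quotient
  \<open>E \<langle>C, C\<^sub>m\<rangle> / E \<parallel>C\<^sub>m\<parallel>\<^sup>2\<close>. Expanding both expectations over pairs of groups leaves the
  probabilities that one or two groups are hit by the first \<open>m\<close> workers; by inclusion-exclusion
  they follow from the probability that a fixed set of workers is missed, and the set of the
  first \<open>m\<close> workers is uniform among all \<open>m\<close>-subsets.

  If the denominator vanishes, then so does the numerator, because a nonnegative affine function
  is constant; the error is then constant and the junk value \<open>x / 0 = 0\<close> is a minimiser too.\<close>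

section \<open>Images of a fixed set under a random permutation\<close>

text \<open>Equal cardinality of \<open>S\<close> and \<open>S'\<close> passes to their complements
  in the finite set \<open>V\<close>, so a bijection between the sets and one between the
  complements glue to a permutation, extended by the identity outside \<open>V\<close>.\<close>

lemma ex_permutes_image_eq:
  assumes "finite V" "S \<subseteq> V" "S' \<subseteq> V" "card S = card S'"
  obtains \<sigma> where "\<sigma> permutes V" "\<sigma> ` S = S'"
proof -
  have fin: "finite S" "finite S'"
    using assms finite_subset by auto
  obtain f where f: "bij_betw f S S'"
    using finite_same_card_bij[OF fin assms(4)] by blast
  have "card (V - S) = card (V - S')"
    using assms fin by (simp add: card_Diff_subset)
  then obtain g where g: "bij_betw g (V - S) (V - S')"
    using finite_same_card_bij[of "V - S" "V - S'"] assms(1) by auto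
  define \<sigma> where "\<sigma> x = (if x \<in> S then f x else if x \<in> V then g x else x)" for x
  have bf: "bij_betw \<sigma> S S'"
    using bij_betw_cong[of S \<sigma> f S'] f by (simp add: \<sigma>_def)
  have bg: "bij_betw \<sigma> (V - S) (V - S')"
    using bij_betw_cong[of "V - S" \<sigma> g "V - S'"] g by (simp add: \<sigma>_def)
  have "bij_betw \<sigma> (S \<union> (V - S)) (S' \<union> (V - S'))"
    by (rule bij_betw_combine[OF bf bg]) auto
  then have "bij_betw \<sigma> V V"
    using assms(2,3) by (simp only: Diff_partition)
  then have "\<sigma> permutes V"
    using assms(2) by (intro bij_imp_permutes) (auto simp: \<sigma>_def)
  moreover have "\<sigma> ` S = S'"
    using bf by (simp add: bij_betw_def)
  ultimately show ?thesis
    using that by blast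
qed

text \<open>Symmetry: composing on the left with a permutation that carries \<open>S\<close> to
  \<open>S'\<close> matches the two families bijectively. This is what makes the image of
  \<open>M\<close> uniform among the subsets of its size.\<close>

lemma card_permutes_image_eq_cong:
  assumes "finite V" "S \<subseteq> V" "S' \<subseteq> V" "card S = card S'"
  shows "card {\<pi>. \<pi> permutes V \<and> \<pi> ` M = S} = card {\<pi>. \<pi> permutes V \<and> \<pi> ` M = S'}"
proof -
  obtain \<sigma> where \<sigma>: "\<sigma> permutes V" "\<sigma> ` S = S'"
    using ex_permutes_image_eq[OF assms] .
  have inv: "inv_into UNIV \<sigma> ` S' = S"
    using \<sigma> by (metis image_inv_f_f permutes_inj)
  have "bij_betw (\<lambda>\<pi>. \<sigma> \<circ> \<pi>) {\<pi>. \<pi> permutes V \<and> \<pi> ` M = S} {\<pi>. \<pi> permutes V \<and> \<pi> ` M = S'}"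
  proof (rule bij_betw_byWitness[where f' = "\<lambda>\<pi>. inv_into UNIV \<sigma> \<circ> \<pi>"])
    show "\<forall>\<pi>\<in>{\<pi>. \<pi> permutes V \<and> \<pi> ` M = S}. inv_into UNIV \<sigma> \<circ> (\<sigma> \<circ> \<pi>) = \<pi>"
      using permutes_inverses(2)[OF \<sigma>(1)] by (auto simp: fun_eq_iff)
    show "\<forall>\<pi>\<in>{\<pi>. \<pi> permutes V \<and> \<pi> ` M = S'}. \<sigma> \<circ> (inv_into UNIV \<sigma> \<circ> \<pi>) = \<pi>"
      using permutes_inverses(1)[OF \<sigma>(1)] by (auto simp: fun_eq_iff)
    show "(\<lambda>\<pi>. \<sigma> \<circ> \<pi>) ` {\<pi>. \<pi> permutes V \<and> \<pi> ` M = S} \<subseteq> {\<pi>. \<pi> permutes V \<and> \<pi> ` M = S'}"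
      using \<sigma> by (auto simp: permutes_compose image_comp[symmetric])
    show "(\<lambda>\<pi>. inv_into UNIV \<sigma> \<circ> \<pi>) ` {\<pi>. \<pi> permutes V \<and> \<pi> ` M = S'} \<subseteq> {\<pi>. \<pi> permutes V \<and> \<pi> ` M = S}"
      using inv permutes_inv[OF \<sigma>(1)]
      by (auto simp: permutes_compose image_comp[symmetric])
  qed
  then show ?thesis
    by (rule bij_betw_same_card)
qed

text \<open>Double counting of pairs of a permutation and the image of \<open>M\<close>: the images
  inside \<open>Y\<close> range over its subsets of size \<open>card M\<close>, and each is attained
  equally often. The common multiplicity is left unevaluated, since only ratios of such counts
  matter later.\<close>

lemma card_permutes_image_subset:
  assumes "finite V" "M \<subseteq> V" "Y \<subseteq> V"
  shows "card {\<pi>. \<pi> permutes V \<and> \<pi> ` M \<subseteq> Y} =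
    card {\<pi>. \<pi> permutes V \<and> \<pi> ` M = M} * (card Y choose card M)"
proof -
  let ?P = "{\<pi>. \<pi> permutes V}" and ?T = "{S. S \<subseteq> Y \<and> card S = card M}"
  have finP: "finite ?P"
    using assms(1) by (rule finite_permutations)
  have finY: "finite Y"
    using assms finite_subset by blast
  have card_image: "card (\<pi> ` M) = card M" if "\<pi> permutes V" for \<pi>
    using that by (meson card_image inj_on_subset permutes_inj subset_UNIV)
  have "card {\<pi>. \<pi> permutes V \<and> \<pi> ` M \<subseteq> Y} = (\<Sum>\<pi>\<in>?P. if \<pi> ` M \<subseteq> Y then 1 else 0)"
    using finP by (simp add: sum.If_cases Collect_conj_eq)
  also have "\<dots> = (\<Sum>\<pi>\<in>?P. card {S \<in> ?T. \<pi> ` M = S})"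
  proof (rule sum.cong)
    fix \<pi> assume "\<pi> \<in> ?P"
    \<comment> \<open>Injectivity gives the image the right size, so it belongs to \<open>?T\<close>
      exactly when it lies in \<open>Y\<close>.\<close>
    then have "{S \<in> ?T. \<pi> ` M = S} = (if \<pi> ` M \<subseteq> Y then {\<pi> ` M} else {})"
      using card_image by auto
    then show "(if \<pi> ` M \<subseteq> Y then 1 else 0) = card {S \<in> ?T. \<pi> ` M = S}"
      by simp
  qed simp
  also have "\<dots> = card {\<pi>. \<pi> permutes V \<and> \<pi> ` M = M} * card ?T"
  proof (rule sum_multicount)
    show "\<forall>S\<in>?T. card {\<pi> \<in> ?P. \<pi> ` M = S} = card {\<pi>. \<pi> permutes V \<and> \<pi> ` M = M}"
    proof
      fix S assume "S \<in> ?T"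
      then have "S \<subseteq> V" "card S = card M"
        using assms(3) by auto
      then show "card {\<pi> \<in> ?P. \<pi> ` M = S} = card {\<pi>. \<pi> permutes V \<and> \<pi> ` M = M}"
        using card_permutes_image_eq_cong[OF assms(1) _ assms(2), of S M] by simp
    qed
    show "finite ?T"
      using finY by simp
  qed (rule finP)
  also have "card ?T = card Y choose card M"
    using finY by (rule n_subsets)
  finally show ?thesis .
qed

text \<open>Avoiding \<open>X\<close> means mapping \<open>M\<close> into \<open>V - X\<close>.
  Counting for \<open>V - X\<close> and for \<open>V\<close> itself yields the same multiplicity,
  which cancels in the quotient.\<close>

lemma prob_permutation_image_disjoint:
  assumes "finite V" "M \<subseteq> V" "X \<subseteq> V"
  shows "measure_pmf.prob (pmf_of_set {\<pi>. \<pi> permutes V}) {\<pi>. X \<inter> \<pi> ` M = {}} =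
    real ((card V - card X) choose card M) / real (card V choose card M)"
proof -
  let ?P = "{\<pi>. \<pi> permutes V}" and ?k = "card {\<pi>. \<pi> permutes V \<and> \<pi> ` M = M}"
  have finP: "finite ?P"
    using assms(1) by (rule finite_permutations)
  have img: "\<pi> ` M \<subseteq> V" if "\<pi> permutes V" for \<pi>
    using that assms(2) permutes_image by blast
  have "?P \<inter> {\<pi>. X \<inter> \<pi> ` M = {}} = {\<pi>. \<pi> permutes V \<and> \<pi> ` M \<subseteq> V - X}"
    using img by blast
  then have num: "card (?P \<inter> {\<pi>. X \<inter> \<pi> ` M = {}}) = ?k * ((card V - card X) choose card M)"
    using assms card_permutes_image_subset[of V M "V - X"]
    by (simp add: card_Diff_subset finite_subset)
  have "?P = {\<pi>. \<pi> permutes V \<and> \<pi> ` M \<subseteq> V}"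
    using img by blast
  then have den: "card ?P = ?k * (card V choose card M)"
    using card_permutes_image_subset[of V M V] assms by simp
  \<comment> \<open>The identity shows that the multiplicity is nonzero, as the cancellation
    requires.\<close>
  have "id \<in> {\<pi>. \<pi> permutes V \<and> \<pi> ` M = M}"
    by (simp add: permutes_id)
  moreover have "finite {\<pi>. \<pi> permutes V \<and> \<pi> ` M = M}"
    by (rule finite_subset[OF _ finP]) auto
  ultimately have "?k \<noteq> 0"
    by (metis card_0_eq empty_iff)
  then have "real ?k \<noteq> 0"
    by (simp only: of_nat_eq_0_iff not_False_eq_True)
  moreover have "?P \<noteq> {}"
    using permutes_id by blast
  ultimately show ?thesis
    by (simp only: measure_pmf_of_set finP num den of_nat_mult mult_divide_mult_cancel_left not_False_eq_True)
qed

section \<open>Least squares for a random partial sum\<close>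

lemma is_arg_min_nonneg_quadratic:
  fixes f :: "real \<Rightarrow> real"
  assumes f: "\<And>\<beta>. f \<beta> = a - 2 * b * \<beta> + d * \<beta>\<^sup>2"
    and nonneg: "\<And>\<beta>. 0 \<le> f \<beta>" and "0 \<le> d"
  shows "is_arg_min f (\<lambda>_. True) (b / d) \<and>
    (d \<noteq> 0 \<longrightarrow> (\<forall>\<beta>. is_arg_min f (\<lambda>_. True) \<beta> \<longrightarrow> \<beta> = b / d))"
proof (cases "d = 0")
  case True
  have "b = 0"
  proof (rule ccontr)
    assume "b \<noteq> 0"
    \<comment> \<open>The witness solves \<open>a - 2 * b * \<beta> = -1\<close>, against
      nonnegativity.\<close>
    then have "f ((a + 1) / (2 * b)) = -1"
      using True by (simp add: f)
    then show False
      using nonneg[of "(a + 1) / (2 * b)"] by simp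
  qed
  then show ?thesis
    using True by (simp add: is_arg_min_def f)
next
  case False
  \<comment> \<open>Completing the square; the excess over the value at \<open>b / d\<close> yields
    both minimality and uniqueness.\<close>
  then have sq: "f \<beta> = f (b / d) + d * (\<beta> - b / d)\<^sup>2" for \<beta>
    by (simp add: f power2_eq_square field_simps)
  have "d > 0"
    using False assms(3) by simp
  have min: "f (b / d) \<le> f \<beta>" for \<beta>
    using sq[of \<beta>] \<open>d > 0\<close> by simp
  have "\<beta> = b / d" if "\<not> f (b / d) < f \<beta>" for \<beta>
  proof -
    have "d * (\<beta> - b / d)\<^sup>2 = 0"
      using that sq[of \<beta>] \<open>d > 0\<close> zero_le_power2[of "\<beta> - b / d"]
        mult_nonneg_nonneg[of d "(\<beta> - b / d)\<^sup>2"] by linarith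
    then show ?thesis
      using \<open>d > 0\<close> by simp
  qed
  with min show ?thesis
    unfolding is_arg_min_def by (auto simp: not_less)
qed

text \<open>Induction on the side of the square: the new last row and column pair up as
  \<open>f i (Suc K) + f (Suc K) i\<close>. No symmetry of \<open>f\<close> is assumed, since the
  mixed expectation gives an asymmetric summand.\<close>

lemma sum_square_split_diagonal:
  fixes f :: "nat \<Rightarrow> nat \<Rightarrow> 'a::comm_monoid_add"
  shows "(\<Sum>i=1..K. \<Sum>j=1..K. f i j) =
    (\<Sum>i=1..K. f i i) + (\<Sum>i=1..K. \<Sum>j\<in>{i<..K}. f i j + f j i)"
proof (induction K)
  case (Suc K)
  have "{i<..Suc K} = insert (Suc K) {i<..K}" if "i \<in> {1..K}" for i
    using that by auto
  then have "(\<Sum>i=1..K. \<Sum>j\<in>{i<..Suc K}. f i j + f j i) =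
      (\<Sum>i=1..K. (f i (Suc K) + f (Suc K) i) + (\<Sum>j\<in>{i<..K}. f i j + f j i))"
    by (intro sum.cong) auto
  then show ?case
    using Suc by (simp add: sum.distrib ac_simps)
qed simp

text \<open>The matrix problem with the coding removed: \<open>P k p\<close> stands for entry
  \<open>p\<close> of the k-th summand, \<open>\<xi> w k\<close> for the indicator that this summand
  is received, and \<open>ip\<close> is the Gram matrix of the summands. Only the first and mixed
  second moments of \<open>\<xi>\<close> enter.\<close>

lemma is_arg_min_expectation_partial_sum:
  fixes D :: "'w pmf" and \<xi> :: "'w \<Rightarrow> nat \<Rightarrow> real" and P :: "nat \<Rightarrow> 'p \<Rightarrow> real"
    and Q :: "'p set" and K :: nat
  defines "ip \<equiv> \<lambda>i j. \<Sum>p\<in>Q. P i p * P j p"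
  assumes fin: "finite (set_pmf D)"
    and idem: "\<And>w k. \<xi> w k * \<xi> w k = \<xi> w k"
    and err: "\<And>\<beta>. err \<beta> = measure_pmf.expectation D
      (\<lambda>w. \<Sum>p\<in>Q. ((\<Sum>k=1..K. P k p) - \<beta> * (\<Sum>k=1..K. \<xi> w k * P k p))\<^sup>2)"
    and g1: "\<And>i. i \<in> {1..K} \<Longrightarrow> measure_pmf.expectation D (\<lambda>w. \<xi> w i) = g1 i"
    and g2: "\<And>i j. i \<in> {1..K} \<Longrightarrow> j \<in> {1..K} \<Longrightarrow> i \<noteq> j \<Longrightarrow>
      measure_pmf.expectation D (\<lambda>w. \<xi> w i * \<xi> w j) = g2 i j"
    and num: "num = (\<Sum>i=1..K. ip i i * g1 i)
      + (\<Sum>i=1..K. \<Sum>j\<in>{i<..K}. ip i j * (g1 i + g1 j))"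
    and den: "den = (\<Sum>i=1..K. ip i i * g1 i)
      + 2 * (\<Sum>i=1..K. \<Sum>j\<in>{i<..K}. ip i j * g2 i j)"
  shows "is_arg_min err (\<lambda>_. True) (num / den) \<and>
    (den \<noteq> 0 \<longrightarrow> (\<forall>\<beta>. is_arg_min err (\<lambda>_. True) \<beta> \<longrightarrow> \<beta> = num / den))"
proof -
  let ?E = "measure_pmf.expectation D"
  define C where "C p = (\<Sum>k=1..K. P k p)" for p
  define X where "X w p = (\<Sum>k=1..K. \<xi> w k * P k p)" for w p
  \<comment> \<open>Finite support makes every function integrable, so the expectation is linear
    without further conditions.\<close>
  have int: "integrable D h" for h :: "'w \<Rightarrow> real"
    using fin by (rule integrable_measure_pmf_finite)
  have ip_commute: "ip i j = ip j i" for i j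
    by (simp add: ip_def mult.commute)

  have "(\<Sum>p\<in>Q. C p * X w p) = (\<Sum>i=1..K. \<Sum>j=1..K. ip i j * \<xi> w j)" for w
  proof -
    have "(\<Sum>p\<in>Q. C p * X w p) = (\<Sum>p\<in>Q. \<Sum>i=1..K. \<Sum>j=1..K. P i p * P j p * \<xi> w j)"
      by (simp add: C_def X_def sum_product ac_simps)
    also have "\<dots> = (\<Sum>i=1..K. \<Sum>j=1..K. \<Sum>p\<in>Q. P i p * P j p * \<xi> w j)"
      by (subst sum.swap, rule sum.cong[OF refl], rule sum.swap)
    finally show ?thesis
      by (simp add: ip_def sum_distrib_right)
  qed
  then have "?E (\<lambda>w. \<Sum>p\<in>Q. C p * X w p) = (\<Sum>i=1..K. \<Sum>j=1..K. ip i j * g1 j)"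
    using int g1 by (simp add: Bochner_Integration.integral_sum)
  \<comment> \<open>The positions (i, j) and (j, i) carry the weights \<open>g1 j\<close> and
    \<open>g1 i\<close>; symmetry of \<open>ip\<close> merges them into
    \<open>ip i j * (g1 i + g1 j)\<close>.\<close>
  also have "\<dots> = num"
    unfolding sum_square_split_diagonal num by (simp add: ip_commute distrib_left add.commute)
  finally have b: "?E (\<lambda>w. \<Sum>p\<in>Q. C p * X w p) = num" .

  have "(\<Sum>p\<in>Q. (X w p)\<^sup>2) = (\<Sum>i=1..K. \<Sum>j=1..K. ip i j * (\<xi> w i * \<xi> w j))" for w
  proof -
    have "(\<Sum>p\<in>Q. (X w p)\<^sup>2) = (\<Sum>p\<in>Q. \<Sum>i=1..K. \<Sum>j=1..K. P i p * P j p * (\<xi> w i * \<xi> w j))"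
      by (simp add: X_def power2_eq_square sum_product ac_simps)
    also have "\<dots> = (\<Sum>i=1..K. \<Sum>j=1..K. \<Sum>p\<in>Q. P i p * P j p * (\<xi> w i * \<xi> w j))"
      by (subst sum.swap, rule sum.cong[OF refl], rule sum.swap)
    finally show ?thesis
      by (simp add: ip_def sum_distrib_right)
  qed
  then have "?E (\<lambda>w. \<Sum>p\<in>Q. (X w p)\<^sup>2) =
      (\<Sum>i=1..K. \<Sum>j=1..K. ip i j * ?E (\<lambda>w. \<xi> w i * \<xi> w j))"
    using int by (simp add: Bochner_Integration.integral_sum)
  \<comment> \<open>On the diagonal, idempotence turns the second moment into the first; off it,
    both orders of a pair contribute equally, hence the factor 2.\<close>
  also have "\<dots> = (\<Sum>i=1..K. ip i i * g1 i) + (\<Sum>i=1..K. \<Sum>j\<in>{i<..K}. 2 * (ip i j * g2 i j))"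
    unfolding sum_square_split_diagonal
  proof (intro arg_cong2[of _ _ _ _ "(+)"] sum.cong refl)
    fix i j assume "i \<in> {1..K}" "j \<in> {i<..K}"
    then show "ip i j * ?E (\<lambda>w. \<xi> w i * \<xi> w j) + ip j i * ?E (\<lambda>w. \<xi> w j * \<xi> w i) =
        2 * (ip i j * g2 i j)"
      using g2[of i j] ip_commute[of j i] by (simp add: mult.commute[of "\<xi> _ j"])
  qed (simp add: idem g1)
  also have "\<dots> = den"
    by (simp add: den sum_distrib_left)
  finally have d: "?E (\<lambda>w. \<Sum>p\<in>Q. (X w p)\<^sup>2) = den" .

  have "err \<beta> = (\<Sum>p\<in>Q. (C p)\<^sup>2) - 2 * num * \<beta> + den * \<beta>\<^sup>2" for \<beta>
  proof -
    have "(\<Sum>p\<in>Q. (C p - \<beta> * X w p)\<^sup>2) =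
        (\<Sum>p\<in>Q. (C p)\<^sup>2) - 2 * \<beta> * (\<Sum>p\<in>Q. C p * X w p) + \<beta>\<^sup>2 * (\<Sum>p\<in>Q. (X w p)\<^sup>2)" for w
      unfolding sum_distrib_left sum_subtractf[symmetric] sum.distrib[symmetric]
      by (rule sum.cong) (auto simp: power2_eq_square algebra_simps)
    then have "err \<beta> = ?E (\<lambda>w. (\<Sum>p\<in>Q. (C p)\<^sup>2) - 2 * \<beta> * (\<Sum>p\<in>Q. C p * X w p)
        + \<beta>\<^sup>2 * (\<Sum>p\<in>Q. (X w p)\<^sup>2))"
      by (simp add: err C_def X_def)
    also have "\<dots> = (\<Sum>p\<in>Q. (C p)\<^sup>2) - 2 * \<beta> * ?E (\<lambda>w. \<Sum>p\<in>Q. C p * X w p)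
        + \<beta>\<^sup>2 * ?E (\<lambda>w. \<Sum>p\<in>Q. (X w p)\<^sup>2)"
      using int by simp
    finally show ?thesis
      by (simp add: b d)
  qed
  moreover have "0 \<le> err \<beta>" for \<beta>
    unfolding err by (intro Bochner_Integration.integral_nonneg sum_nonneg) simp
  moreover have "0 \<le> den"
    unfolding d[symmetric] by (intro Bochner_Integration.integral_nonneg sum_nonneg) simp
  ultimately show ?thesis
    by (rule is_arg_min_nonneg_quadratic)
qed

section \<open>The coding scheme\<close>

text \<open>Summing over index pairs treats a matrix as a vector, the form in which the
  least-squares lemma is stated.\<close>

lemma frob_norm_sq:
  "(frob_norm M)\<^sup>2 = (\<Sum>p\<in>{..<dim_row M} \<times> {..<dim_col M}. (M $$ p)\<^sup>2)"
  by (simp add: frob_norm_def sum_nonneg sum.cartesian_product)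

text \<open>The trace form is the Frobenius inner product; this identifies \<open>M_pair\<close>
  with Gram entries.\<close>

lemma mat_trace_transpose_mult:
  assumes "M \<in> carrier_mat nr nc" "M' \<in> carrier_mat nr nc"
  shows "mat_trace (transpose_mat M * M') = (\<Sum>p\<in>{..<nr} \<times> {..<nc}. M $$ p * M' $$ p)"
proof -
  have "mat_trace (transpose_mat M * M') = (\<Sum>j<nc. \<Sum>i<nr. M $$ (i, j) * M' $$ (i, j))"
    using assms by (simp add: mat_trace_def scalar_prod_def atLeast0LessThan)
  also have "\<dots> = (\<Sum>i<nr. \<Sum>j<nc. M $$ (i, j) * M' $$ (i, j))"
    by (rule sum.swap)
  finally show ?thesis
    by (simp add: sum.cartesian_product split_def)
qed

text \<open>Inclusion-exclusion over the events of missing \<open>X\<close> or \<open>Y\<close>;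
  missing both is missing their union, so every term is a single avoidance probability.\<close>

lemma expectation_hit_permutation:
  fixes m N :: nat
  assumes "m \<le> N" "X \<subseteq> {1..N}" "Y \<subseteq> {1..N}" "X \<inter> Y = {}"
  defines "D \<equiv> pmf_of_set {\<pi>. \<pi> permutes {1..N}}"
    and "hit \<equiv> \<lambda>Z \<pi>. of_bool (card (Z \<inter> \<pi> ` {1..m}) > 0) :: real"
  shows "measure_pmf.expectation D (hit X) =
      (real (N choose m) - real ((N - card X) choose m)) / real (N choose m)"
    and "measure_pmf.expectation D (\<lambda>\<pi>. hit X \<pi> * hit Y \<pi>) =
      (real (N choose m) - real ((N - card X) choose m) - real ((N - card Y) choose m)
        + real ((N - card X - card Y) choose m)) / real (N choose m)"
proof -
  define miss where "miss Z = {\<pi>. Z \<inter> \<pi> ` {1..m} = {}}" for Z :: "nat set"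
  have "{\<pi>. \<pi> permutes {1..N}} \<noteq> {}"
    using permutes_id by blast
  then have "set_pmf D = {\<pi>. \<pi> permutes {1..N}}"
    unfolding D_def by (simp add: finite_permutations)
  then have int: "integrable D h" for h :: "_ \<Rightarrow> real"
    by (simp add: integrable_measure_pmf_finite finite_permutations)
  \<comment> \<open>If fewer than \<open>m\<close> workers lie outside \<open>Z\<close>, the
    binomial coefficient is 0, as it must be because \<open>Z\<close> is then always hit.\<close>
  have prob: "measure_pmf.prob D (miss Z) = real ((N - card Z) choose m) / real (N choose m)"
    if "Z \<subseteq> {1..N}" for Z
    using prob_permutation_image_disjoint[of "{1..N}" "{1..m}" Z] that assms(1)
    by (simp add: D_def miss_def)
  have hit: "hit Z \<pi> = 1 - indicator (miss Z) \<pi>" if "Z \<subseteq> {1..N}" for Z \<pi>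
    using finite_subset[OF that] by (simp add: hit_def miss_def card_gt_0_iff indicator_def)
  have pos: "real (N choose m) > 0"
    using assms(1) by simp
  have "measure_pmf.expectation D (hit X) = 1 - measure_pmf.prob D (miss X)"
    using int by (simp add: hit[OF assms(2)] cong: Bochner_Integration.integral_cong)
  then show "measure_pmf.expectation D (hit X) =
      (real (N choose m) - real ((N - card X) choose m)) / real (N choose m)"
    using pos by (simp add: prob[OF assms(2)] diff_divide_distrib)
  have both: "hit X \<pi> * hit Y \<pi> =
      1 - indicator (miss X) \<pi> - indicator (miss Y) \<pi> + indicator (miss (X \<union> Y)) \<pi>" for \<pi>
    unfolding hit[OF assms(2)] hit[OF assms(3)]
    by (auto simp: miss_def indicator_def)
  have "measure_pmf.expectation D (\<lambda>\<pi>. hit X \<pi> * hit Y \<pi>) =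
      1 - measure_pmf.prob D (miss X) - measure_pmf.prob D (miss Y)
        + measure_pmf.prob D (miss (X \<union> Y))"
    unfolding both using int by simp
  \<comment> \<open>Disjointness turns \<open>N - card (X \<union> Y)\<close> into
    \<open>N - card X - card Y\<close>.\<close>
  moreover have "card (X \<union> Y) = card X + card Y"
    using assms(2-4) by (intro card_Un_disjoint) (auto intro: finite_subset)
  ultimately show "measure_pmf.expectation D (\<lambda>\<pi>. hit X \<pi> * hit Y \<pi>) =
      (real (N choose m) - real ((N - card X) choose m) - real ((N - card Y) choose m)
        + real ((N - card X - card Y) choose m)) / real (N choose m)"
    using pos prob[of X] prob[of Y] prob[of "X \<union> Y"] assms(2,3)
    by (simp add: diff_divide_distrib add_divide_distrib)
qed

theorem theorem2:
  fixes Nx Nz Ny K N m :: nat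
    and A B :: "real mat"
    and T :: "nat \<Rightarrow> real poly"
    and y \<alpha> :: "nat \<Rightarrow> real"
    and G :: "nat \<Rightarrow> nat set"
    and n :: "nat \<Rightarrow> nat"
    and D :: "(nat \<Rightarrow> nat) pmf"
  assumes "point_based_scheme Nx Nz Ny K A B T y \<alpha>"
    and "N \<ge> 2 * K - 1"
    and "worker_groups N K G n"
    and "(\<Sum>k=1..K. n k) = N"
    and "m \<in> {1..2 * K - 2}"
    and "D = pmf_of_set {\<pi>. \<pi> permutes {1..N}}"
  shows "let err = expected_error D K T A B y \<alpha> G m;
             M1 = M_single K T A B y \<alpha>;
             M2 = M_pair K T A B y \<alpha>;
             g1 = gamma_single N m n;
             g2 = gamma_pair N m n;
             num = (\<Sum>i=1..K. M1 i * g1 i)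
                     + (\<Sum>i=1..K. \<Sum>j\<in>{i<..K}. M2 i j * (g1 i + g1 j));
             den = (\<Sum>i=1..K. M1 i * g1 i)
                     + 2 * (\<Sum>i=1..K. \<Sum>j\<in>{i<..K}. M2 i j * g2 i j);
             \<beta>' = num / den
         in is_arg_min err (\<lambda>_. True) \<beta>' \<and>
            (den \<noteq> 0 \<longrightarrow> (\<forall>\<beta>. is_arg_min err (\<lambda>_. True) \<beta> \<longrightarrow> \<beta> = \<beta>'))"
proof -
  define E where "E k = encoded_product K T A B (y k)" for k
  \<comment> \<open>Absorbing the scalar \<alpha> into the summand makes \<open>M_single\<close> and
    \<open>M_pair\<close> exactly the Gram entries of \<open>P\<close>.\<close>
  define P where "P k p = \<alpha> k * E k $$ p" for k p
  define \<xi> where "\<xi> \<pi> k = (of_bool (group_count G m \<pi> k > 0) :: real)" for \<pi> k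
  define Q where "Q = {..<Nx} \<times> {..<Ny}"
  note scheme = assms(1)[unfolded point_based_scheme_def]
  have dims: "dim_row A = Nx" "dim_col B = Ny"
    using scheme by auto
  have E_carrier: "E k \<in> carrier_mat Nx Ny" for k
    by (rule carrier_matI)
      (simp_all add: E_def encoded_product_def encode_A_def encode_B_def mat_sum_def dims)
  then have E_dims: "dim_row (E k) = Nx" "dim_col (E k) = Ny" for k
    by auto

  have "A * B = mat_sum Nx Ny (\<lambda>k. \<alpha> k \<cdot>\<^sub>m E k) {1..K}"
    using scheme by (simp add: E_def)
  then have C: "(A * B) $$ p = (\<Sum>k=1..K. P k p)" if "p \<in> Q" for p
    using that E_dims by (auto simp: Q_def mat_sum_def P_def)
  have est: "estimate K T A B y \<alpha> G m \<pi> $$ p = (\<Sum>k=1..K. \<xi> \<pi> k * P k p)" if "p \<in> Q" for \<pi> p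
    using that E_dims by (auto simp: Q_def estimate_def mat_sum_def P_def \<xi>_def dims E_def[symmetric]
        ac_simps)
  have err: "expected_error D K T A B y \<alpha> G m \<beta> = measure_pmf.expectation D
      (\<lambda>\<pi>. \<Sum>p\<in>Q. ((\<Sum>k=1..K. P k p) - \<beta> * (\<Sum>k=1..K. \<xi> \<pi> k * P k p))\<^sup>2)" for \<beta>
  proof -
    have est_dims: "dim_row (estimate K T A B y \<alpha> G m \<pi>) = Nx"
        "dim_col (estimate K T A B y \<alpha> G m \<pi>) = Ny" for \<pi>
      by (simp_all add: estimate_def mat_sum_def dims)
    have "(frob_norm (A * B - \<beta> \<cdot>\<^sub>m estimate K T A B y \<alpha> G m \<pi>))\<^sup>2 =
        (\<Sum>p\<in>Q. ((\<Sum>k=1..K. P k p) - \<beta> * (\<Sum>k=1..K. \<xi> \<pi> k * P k p))\<^sup>2)" for \<pi>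
      unfolding frob_norm_sq
    proof (rule sum.cong)
      fix p assume "p \<in> Q"
      then have "(A * B - \<beta> \<cdot>\<^sub>m estimate K T A B y \<alpha> G m \<pi>) $$ p =
          (A * B) $$ p - \<beta> * estimate K T A B y \<alpha> G m \<pi> $$ p"
        by (auto simp: Q_def est_dims)
      then show "((A * B - \<beta> \<cdot>\<^sub>m estimate K T A B y \<alpha> G m \<pi>) $$ p)\<^sup>2 =
          ((\<Sum>k=1..K. P k p) - \<beta> * (\<Sum>k=1..K. \<xi> \<pi> k * P k p))\<^sup>2"
        using \<open>p \<in> Q\<close> by (simp add: C est)
    qed (simp add: Q_def est_dims)
    then show ?thesis
      by (simp add: expected_error_def)
  qed

  have M1: "M_single K T A B y \<alpha> i = (\<Sum>p\<in>Q. P i p * P i p)" for i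
    unfolding M_single_def E_def[symmetric] frob_norm_sq
    by (simp add: E_dims Q_def P_def sum_distrib_left power2_eq_square ac_simps)
  have M2: "M_pair K T A B y \<alpha> i j = (\<Sum>p\<in>Q. P i p * P j p)" for i j
    by (simp add: M_pair_def E_def[symmetric] mat_trace_transpose_mult[OF E_carrier E_carrier]
        Q_def P_def sum_distrib_left ac_simps)

  have "m \<le> N"
    using assms(2,5) by auto
  have G: "G i \<subseteq> {1..N}" "card (G i) = n i" if "i \<in> {1..K}" for i
    using assms(3) that unfolding worker_groups_def by blast+
  have G_disjoint: "G i \<inter> G j = {}" if "i \<in> {1..K}" "j \<in> {1..K}" "i \<noteq> j" for i j
    using assms(3) that unfolding worker_groups_def disjoint_family_on_def by blast
  have g1: "measure_pmf.expectation D (\<lambda>\<pi>. \<xi> \<pi> i) = gamma_single N m n i" if "i \<in> {1..K}" for i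
    \<comment> \<open>The empty second set satisfies the shared disjointness hypothesis
      trivially.\<close>
    using expectation_hit_permutation(1)[OF \<open>m \<le> N\<close> G(1)[OF that], of "{}"]
    by (simp add: \<xi>_def group_count_def gamma_single_def assms(6) G(2)[OF that])
  have g2: "measure_pmf.expectation D (\<lambda>\<pi>. \<xi> \<pi> i * \<xi> \<pi> j) = gamma_pair N m n i j"
    if ij: "i \<in> {1..K}" "j \<in> {1..K}" "i \<noteq> j" for i j
    using expectation_hit_permutation(2)[OF \<open>m \<le> N\<close> G(1) G(1) G_disjoint, OF ij(1,2) ij]
    by (simp add: \<xi>_def group_count_def gamma_pair_def assms(6) G(2)[OF ij(1)] G(2)[OF ij(2)])
  \<comment> \<open>The support of \<open>pmf_of_set\<close> is the given set only when that set is
    finite and nonempty.\<close>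
  have "{\<pi>. \<pi> permutes {1..N}} \<noteq> {}"
    using permutes_id by blast
  then have fin: "finite (set_pmf D)"
    by (simp add: assms(6) finite_permutations)
  have idem: "\<xi> \<pi> k * \<xi> \<pi> k = \<xi> \<pi> k" for \<pi> k
    by (simp add: \<xi>_def of_bool_def)
  show ?thesis
    unfolding Let_def
    by (rule is_arg_min_expectation_partial_sum[where P = P and Q = Q,
          OF fin idem err g1 g2]) (simp_all add: M1 M2)
qed

end
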